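(* Let $U,V$ be linear subspaces of $\mathbb{R}^n$ and let $x\in\mathbb{R}^n$. Then the three sequences $$\{C_T^k(P_U(x))\}_{k\in\mathbb{N}},\qquad \{C_T^k(P_V(x))\}_{k\in\mathbb{N}},\qquad \{C_T^k(P_{U+V}(x))\}_{k\in\mathbb{N}}$$ converge linearly to $P_{U\cap V}(x)$. Moreover, their rate of convergence is at least the cosine of the Friedrichs angle $c_F=c_F(U,V)\in[0,1)$; that is, for each of these sequences $\{s^k\}$ there is a constant $M\ge 0$ such that $\|s^k-P_{U\cap V}(x)\|\le M\,c_F^k$ for all $k\in\mathbb{N}$.
   Context: $\mathbb{R}^n$ carries the Euclidean inner product $\langle\cdot,\cdot\rangle$ and norm $\|\cdot\|$. For a nonempty closed convex set $S\subset\mathbb{R}^n$, $P_S$ is the orthogonal projection onto $S$ and $R_S=2P_S-\mathrm{Id}$ is the reflection. Given subspaces $U,V$ and a point $x\in\mathbb{R}^n$, set $y=R_U(x)$ and $z=R_VR_U(x)$. The circumcentering operator $C_T:\mathbb{R}^n\to\mathbb{R}^n$ is defined by letting $C_T(x)$ be the circumcenter of $\{x,y,z\}$, i.e. the unique point of the affine hull $\operatorname{aff}\{x,y,z\}$ that is equidistant to $x$, $y$ and $z$ (it exists and is unique for every $x$; if $x,y,z$ all coincide it is $x$, and if $\{x,y,z\}$ has exactly two elements it is their midpoint). $C_T^k$ denotes the $k$-fold composition of $C_T$. The cosine of the Friedrichs angle between $U$ and $V$ is $$c_F(U,V)=\sup\{\langle u,v\rangle : u\in U\cap(U\cap V)^\perp,\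 v\in V\cap(U\cap V)^\perp,\ \|u\|\le 1,\ \|v\|\le 1\}.$$ *)

theory Defs
  imports "HOL-Analysis.Analysis"
begin

text \<open>The orthogonal projection onto a nonempty closed convex set \<open>S\<close> is the library's
  \<open>closest_point S\<close>; sums of subspaces are the Minkowski sums of \<open>HOL-Library.Set_Algebras\<close>.\<close>

definition reflection :: "'a::euclidean_space set \<Rightarrow> 'a \<Rightarrow> 'a" where
  "reflection S x = 2 *\<^sub>R closest_point S x - x"

definition circumcenter :: "'a::euclidean_space set \<Rightarrow> 'a" where
  "circumcenter A = (THE c. c \<in> affine hull A \<and> (\<exists>r. \<forall>a\<in>A. dist c a = r))"

definition circumcentering :: "'a::euclidean_space set \<Rightarrow> 'a set \<Rightarrow> 'a \<Rightarrow> 'a" where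
  "circumcentering U V x =
     circumcenter {x, reflection U x, reflection V (reflection U x)}"

definition friedrichs_cos :: "'a::euclidean_space set \<Rightarrow> 'a set \<Rightarrow> real" where
  "friedrichs_cos U V =
     Sup {u \<bullet> v | u v. u \<in> U \<inter> (U \<inter> V)\<^sup>\<bottom> \<and> v \<in> V \<inter> (U \<inter> V)\<^sup>\<bottom> \<and> norm u \<le> 1 \<and> norm v \<le> 1}"

text \<open>For \<open>q = 0\<close> the bound reads \<open>norm (s 0 - l) \<le> M\<close> and \<open>s k = l\<close> for all \<open>k \<ge> 1\<close>,
  since \<open>0 ^ 0 = 1\<close>.\<close>

definition converges_linearly :: "(nat \<Rightarrow> 'a::euclidean_space) \<Rightarrow> 'a \<Rightarrow> real \<Rightarrow> bool" where
  "converges_linearly s l q \<longleftrightarrow>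
     0 \<le> q \<and> q < 1 \<and> s \<longlonglongrightarrow> l \<and> (\<exists>M\<ge>0. \<forall>k. norm (s k - l) \<le> M * q ^ k)"

end

theory Submission
  imports Defs
begin

text \<open>
  Write \<open>w\<close> for the projection of \<open>x\<close> onto \<open>U \<inter> V\<close> and \<open>c\<close> for the Friedrichs cosine. Reflections
  in \<open>U\<close> and \<open>V\<close> are isometries fixing \<open>w\<close>, so \<open>w\<close> has the same distance to \<open>s\<close>, \<open>R\<^sub>U s\<close> and
  \<open>R\<^sub>V R\<^sub>U s\<close>. By Pythagoras its projection onto the affine hull of these three points is
  equidistant to them as well, hence it is the circumcenter
  (\<open>circumcenter_eq_closest_point\<close>). The circumcenter is therefore at least as close to \<open>w\<close> as
  any other point of that affine hull, in particular as the midpoint of \<open>s\<close> and \<open>R\<^sub>V R\<^sub>U s\<close>,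
  which is the image of \<open>s\<close> under the Douglas-Rachford operator.

  It remains to see that this operator contracts towards \<open>w\<close> by the factor \<open>c\<close>. With \<open>P'\<close> denoting
  projection onto the orthogonal complement, it equals \<open>P\<^sub>V P\<^sub>U + P'\<^sub>V P'\<^sub>U\<close>, a sum with orthogonal
  terms. The first term is controlled by the definition of \<open>c\<close>; the second one by the fact that the
  Friedrichs cosine does not increase on passing to orthogonal complements
  (\<open>norm_complement_projection_le\<close>). The estimate needs \<open>s \<in> U + V\<close> and \<open>s - w\<close>
  orthogonal to \<open>U \<inter> V\<close>. Both conditions define affine sets invariant under the two reflections, so
  they pass from \<open>s\<close> to its circumcenter, and all three starting points satisfy them. The
  contraction can thus be iterated. Finally \<open>c < 1\<close> because the supremum defining \<open>c\<close> is attained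
  by compactness, and the value \<open>1\<close> would force a unit vector in \<open>U \<inter> V\<close> orthogonal to \<open>U \<inter> V\<close>.
\<close>

section \<open>Projections onto affine sets and subspaces\<close>

text \<open>The variational inequality holds with equality here, since with a point \<open>y\<close> an affine
  set also contains its mirror image in the closest point.\<close>

lemma closest_point_affine_orthogonal:
  fixes S :: "'a::euclidean_space set"
  assumes S: "affine S" and y: "y \<in> S"
  shows "(x - closest_point S x) \<bullet> (y - closest_point S x) = 0"
proof -
  let ?p = "closest_point S x"
  have cl: "closed S" "convex S" "S \<noteq> {}"
    using S y affine_imp_convex affine_closed by auto
  have p: "?p \<in> S" using cl by (simp add: closest_point_in_set)
  have "2 *\<^sub>R ?p + (-1) *\<^sub>R y \<in> S"
    using S p y by (rule mem_affine) simp
  then have "(x - ?p) \<bullet> (2 *\<^sub>R ?p + (-1) *\<^sub>R y - ?p) \<le> 0"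
    using cl closest_point_dot by blast
  also have "2 *\<^sub>R ?p + (-1) *\<^sub>R y - ?p = - (y - ?p)"
    by (simp add: scaleR_2)
  finally have "0 \<le> (x - ?p) \<bullet> (y - ?p)"
    by (simp only: inner_minus_right neg_le_0_iff_le)
  moreover have "(x - ?p) \<bullet> (y - ?p) \<le> 0"
    using cl y closest_point_dot by blast
  ultimately show ?thesis by simp
qed

lemma closest_point_subspace_in:
  fixes S :: "'a::euclidean_space set"
  assumes "subspace S"
  shows "closest_point S x \<in> S"
  using assms closed_subspace closest_point_in_set subspace_0 by blast

lemma closest_point_subspace_orthogonal:
  fixes S :: "'a::euclidean_space set"
  assumes S: "subspace S" and y: "y \<in> S"
  shows "(x - closest_point S x) \<bullet> y = 0"
proof -
  have "y + closest_point S x \<in> S"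
    using S y closest_point_subspace_in subspace_add by blast
  from closest_point_affine_orthogonal[OF subspace_imp_affine[OF S] this, of x]
  show ?thesis by simp
qed

lemma closest_point_subspace_unique:
  fixes S :: "'a::euclidean_space set"
  assumes S: "subspace S" and p: "p \<in> S" and orth: "\<And>y. y \<in> S \<Longrightarrow> (x - p) \<bullet> y = 0"
  shows "closest_point S x = p"
proof -
  let ?q = "closest_point S x"
  have d: "p - ?q \<in> S"
    using S p closest_point_subspace_in subspace_diff by blast
  have "(p - ?q) \<bullet> (p - ?q) = (x - ?q) \<bullet> (p - ?q) - (x - p) \<bullet> (p - ?q)"
    by (simp add: inner_diff_left)
  also have "\<dots> = 0"
    using closest_point_subspace_orthogonal[OF S d] orth[OF d] by simp
  finally show ?thesis by simp
qed

lemma closest_point_subspace_linear: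
  fixes S :: "'a::euclidean_space set"
  assumes S: "subspace S"
  shows "linear (closest_point S)"
proof (rule linearI)
  note [simp] = closest_point_subspace_orthogonal[OF S]
  note [intro] = closest_point_subspace_in[OF S] subspace_add[OF S] subspace_scale[OF S]
  show "closest_point S (x + y) = closest_point S x + closest_point S y" for x y
  proof (rule closest_point_subspace_unique[OF S])
    fix v assume v: "v \<in> S"
    have "(x + y - (closest_point S x + closest_point S y)) \<bullet> v
        = (x - closest_point S x) \<bullet> v + (y - closest_point S y) \<bullet> v"
      by (simp add: inner_diff_left inner_add_left)
    then show "(x + y - (closest_point S x + closest_point S y)) \<bullet> v = 0"
      using v by simp
  qed auto
  show "closest_point S (r *\<^sub>R x) = r *\<^sub>R closest_point S x" for r x
  proof (rule closest_point_subspace_unique[OF S])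
    fix v assume v: "v \<in> S"
    have "(r *\<^sub>R x - r *\<^sub>R closest_point S x) \<bullet> v = r * ((x - closest_point S x) \<bullet> v)"
      by (simp add: inner_diff_left right_diff_distrib)
    then show "(r *\<^sub>R x - r *\<^sub>R closest_point S x) \<bullet> v = 0"
      using v by simp
  qed auto
qed

lemma closest_point_in_orthogonal_comp:
  fixes S M :: "'a::euclidean_space set"
  assumes S: "subspace S" and sub: "M \<subseteq> S" and x: "x \<in> M\<^sup>\<bottom>"
  shows "closest_point S x \<in> M\<^sup>\<bottom>"
proof -
  have "y \<bullet> closest_point S x = 0" if y: "y \<in> M" for y
  proof -
    have "(x - closest_point S x) \<bullet> y = 0"
      using closest_point_subspace_orthogonal[OF S] sub y by blast
    moreover have "y \<bullet> x = 0"
      using x y by (auto simp: orthogonal_comp_def orthogonal_def)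
    ultimately show ?thesis
      by (simp add: inner_diff_left inner_diff_right inner_commute)
  qed
  then show ?thesis
    by (auto simp: orthogonal_comp_def orthogonal_def)
qed

lemma norm_closest_point_subspace_Pythagorean:
  fixes S :: "'a::euclidean_space set"
  assumes S: "subspace S"
  shows "(norm x)\<^sup>2 = (norm (closest_point S x))\<^sup>2 + (norm (x - closest_point S x))\<^sup>2"
proof -
  have "orthogonal (closest_point S x) (x - closest_point S x)"
    using closest_point_subspace_orthogonal[OF S closest_point_subspace_in[OF S], of x x]
    by (simp add: orthogonal_def inner_commute)
  from norm_add_Pythagorean[OF this] show ?thesis by simp
qed

lemma dist_reflection_fixed_point:
  fixes S :: "'a::euclidean_space set"
  assumes S: "subspace S" and w: "w \<in> S"
  shows "dist w (reflection S x) = dist w x"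
proof -
  let ?p = "closest_point S x"
  have "(x - ?p) \<bullet> (w - ?p) = 0"
    using closest_point_affine_orthogonal[OF subspace_imp_affine[OF S] w] .
  then have "(norm ((w - ?p) + (x - ?p)))\<^sup>2 = (norm ((w - ?p) - (x - ?p)))\<^sup>2"
    by (simp add: power2_norm_eq_inner inner_diff_left inner_diff_right inner_add_left
        inner_add_right inner_commute)
  moreover have "(w - ?p) + (x - ?p) = w - reflection S x" "(w - ?p) - (x - ?p) = w - x"
    by (simp_all add: reflection_def scaleR_2)
  ultimately show ?thesis
    by (simp add: dist_norm)
qed

section \<open>The circumcenter as a projection\<close>

text \<open>Equidistance from \<open>A\<close> survives projection onto \<open>affine hull A\<close> by Pythagoras, which gives
  existence. For uniqueness, two equidistant points have a difference \<open>d\<close> with a constant inner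
  product on \<open>A\<close>, hence on \<open>affine hull A\<close>; if both points lie there, then \<open>d \<bullet> d = 0\<close>.\<close>

lemma circumcenter_eq_closest_point:
  fixes A :: "'a::euclidean_space set"
  assumes ne: "A \<noteq> {}" and equi: "\<And>a. a \<in> A \<Longrightarrow> dist w a = r"
  shows "circumcenter A = closest_point (affine hull A) w"
proof -
  let ?L = "affine hull A" and ?c = "closest_point (affine hull A) w"
  have cL: "?c \<in> ?L"
    using ne by (simp add: closest_point_in_set)
  have c_equi: "(dist ?c a)\<^sup>2 = r\<^sup>2 - (norm (w - ?c))\<^sup>2" if a: "a \<in> A" for a
  proof -
    have "(w - ?c) \<bullet> (a - ?c) = 0"
      using a by (intro closest_point_affine_orthogonal) (auto simp: hull_inc)
    then have "(norm ((w - ?c) - (a - ?c)))\<^sup>2 = (norm (w - ?c))\<^sup>2 + (norm (a - ?c))\<^sup>2"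
      by (simp add: power2_norm_eq_inner inner_diff_left inner_diff_right inner_commute)
    then show ?thesis
      using equi[OF a] by (simp add: dist_norm norm_minus_commute)
  qed
  show ?thesis
    unfolding circumcenter_def
  proof (rule the_equality)
    have "dist ?c a = sqrt (r\<^sup>2 - (norm (w - ?c))\<^sup>2)" if "a \<in> A" for a
      using c_equi[OF that] by (metis real_sqrt_unique zero_le_dist)
    then show "?c \<in> ?L \<and> (\<exists>r. \<forall>a\<in>A. dist ?c a = r)"
      using cL by blast
  next
    fix c' assume c': "c' \<in> ?L \<and> (\<exists>r. \<forall>a\<in>A. dist c' a = r)"
    then obtain r' where r': "\<And>a. a \<in> A \<Longrightarrow> dist c' a = r'" by blast
    \<comment> \<open>Subtracting the two equidistance equations for \<open>a\<close> cancels \<open>a \<bullet> a\<close>; the remaining equation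
      is linear in \<open>a\<close> and has this right-hand side.\<close>
    let ?k = "(c' \<bullet> c' - r'\<^sup>2 - ?c \<bullet> ?c + (r\<^sup>2 - (norm (w - ?c))\<^sup>2)) / 2"
    have "(c' - ?c) \<bullet> a = ?k" if a: "a \<in> A" for a
    proof -
      have "(c' - a) \<bullet> (c' - a) = r'\<^sup>2"
        using r'[OF a] by (metis dist_norm power2_norm_eq_inner)
      moreover have "(?c - a) \<bullet> (?c - a) = r\<^sup>2 - (norm (w - ?c))\<^sup>2"
        using c_equi[OF a] by (metis dist_norm power2_norm_eq_inner)
      ultimately show ?thesis
        by (simp add: inner_diff_left inner_diff_right inner_commute)
    qed
    then have "?L \<subseteq> {y. (c' - ?c) \<bullet> y = ?k}"
      by (intro hull_minimal affine_hyperplane) auto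
    then have "(c' - ?c) \<bullet> c' = ?k" "(c' - ?c) \<bullet> ?c = ?k"
      using c' cL by blast+
    then have "(c' - ?c) \<bullet> (c' - ?c) = 0"
      by (simp add: inner_diff_right)
    then show "c' = ?c" by simp
  qed
qed

section \<open>The Friedrichs angle\<close>

lemma friedrichs_cos_set_compact:
  fixes U V :: "'a::euclidean_space set"
  assumes U: "subspace U" and V: "subspace V"
  shows "compact {u \<bullet> v | u v. u \<in> U \<inter> (U \<inter> V)\<^sup>\<bottom> \<and> v \<in> V \<inter> (U \<inter> V)\<^sup>\<bottom> \<and> norm u \<le> 1 \<and> norm v \<le> 1}"
    (is "compact ?S")
proof -
  let ?A = "\<lambda>W. (W \<inter> (U \<inter> V)\<^sup>\<bottom>) \<inter> cball 0 1"
  have "compact (?A W)" if "subspace W" for W :: "'a set"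
    using that by (intro closed_Int_compact closed_Int closed_subspace subspace_orthogonal_comp) auto
  then have "compact (?A U \<times> ?A V)"
    using U V compact_Times by blast
  then have "compact ((\<lambda>p. fst p \<bullet> snd p) ` (?A U \<times> ?A V))"
    by (intro compact_continuous_image continuous_intros)
  also have "(\<lambda>p. fst p \<bullet> snd p) ` (?A U \<times> ?A V) = ?S"
    by (force simp: image_iff)
  finally show ?thesis .
qed

lemma friedrichs_cos_bounds:
  fixes U V :: "'a::euclidean_space set"
  assumes U: "subspace U" and V: "subspace V"
  shows "0 \<le> friedrichs_cos U V" and "friedrichs_cos U V < 1"
proof -
  let ?S = "{u \<bullet> v | u v. u \<in> U \<inter> (U \<inter> V)\<^sup>\<bottom> \<and> v \<in> V \<inter> (U \<inter> V)\<^sup>\<bottom> \<and> norm u \<le> 1 \<and> norm v \<le> 1}"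
  have compact: "compact ?S" using friedrichs_cos_set_compact[OF U V] .
  have zero: "0 \<in> ?S"
    using subspace_0[OF U] subspace_0[OF V] subspace_0[OF subspace_orthogonal_comp[of "U \<inter> V"]]
    by (intro CollectI exI[of _ 0]) auto
  show "0 \<le> friedrichs_cos U V"
    unfolding friedrichs_cos_def
    using zero compact by (intro cSup_upper bounded_imp_bdd_above compact_imp_bounded)
  have "Sup ?S \<in> ?S"
    using compact zero by (intro closed_contains_Sup bounded_imp_bdd_above compact_imp_bounded
        compact_imp_closed) auto
  then obtain u v where uv: "friedrichs_cos U V = u \<bullet> v" "u \<in> U" "u \<in> (U \<inter> V)\<^sup>\<bottom>" "v \<in> V"
      "norm u \<le> 1" "norm v \<le> 1"
    unfolding friedrichs_cos_def by blast
  show "friedrichs_cos U V < 1"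
  proof (rule ccontr)
    assume "\<not> friedrichs_cos U V < 1"
    then have ge: "1 \<le> u \<bullet> v" using uv by simp
    have "u \<bullet> u \<le> 1" "v \<bullet> v \<le> 1"
      using uv by (simp_all add: norm_le_square)
    then have "(u - v) \<bullet> (u - v) \<le> 0"
      using ge by (simp add: inner_diff_left inner_diff_right inner_commute)
    then have "u = v"
      by (metis eq_iff_diff_eq_0 inner_eq_zero_iff inner_ge_zero order_antisym)
    then have "u \<in> U \<inter> V" using uv by simp
    then have "u \<bullet> u = 0"
      using uv by (auto simp: orthogonal_comp_def orthogonal_def)
    then show False using ge \<open>u = v\<close> by simp
  qed
qed

lemma inner_le_friedrichs_cos:
  fixes U V :: "'a::euclidean_space set"
  assumes U: "subspace U" and V: "subspace V"
    and u: "u \<in> U" "u \<in> (U \<inter> V)\<^sup>\<bottom>" and v: "v \<in> V" "v \<in> (U \<inter> V)\<^sup>\<bottom>"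
  shows "u \<bullet> v \<le> friedrichs_cos U V * norm u * norm v"
proof (cases "u = 0 \<or> v = 0")
  case False
  have unit: "inverse (norm y) *\<^sub>R y \<in> W \<inter> (U \<inter> V)\<^sup>\<bottom>"
    if "subspace W" "y \<in> W" "y \<in> (U \<inter> V)\<^sup>\<bottom>" for W and y :: 'a
    using that subspace_scale subspace_orthogonal_comp by blast
  have "(inverse (norm u) *\<^sub>R u) \<bullet> (inverse (norm v) *\<^sub>R v) \<le> friedrichs_cos U V"
    unfolding friedrichs_cos_def
  proof (rule cSup_upper)
    show "bdd_above {u \<bullet> v | u v. u \<in> U \<inter> (U \<inter> V)\<^sup>\<bottom> \<and> v \<in> V \<inter> (U \<inter> V)\<^sup>\<bottom> \<and> norm u \<le> 1 \<and> norm v \<le> 1}"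
      by (rule bounded_imp_bdd_above[OF compact_imp_bounded[OF friedrichs_cos_set_compact[OF U V]]])
  qed (use unit[OF U u] unit[OF V v] False in \<open>auto intro!: exI\<close>)
  then show ?thesis
    using False by (simp add: field_simps)
qed auto

lemma friedrichs_cos_commute: "friedrichs_cos U V = friedrichs_cos V U"
  unfolding friedrichs_cos_def Int_commute[of V U]
  by (rule arg_cong[where f = Sup]) (force simp: inner_commute)

lemma norm_projection_le:
  fixes U V :: "'a::euclidean_space set"
  assumes U: "subspace U" and V: "subspace V"
    and y: "y \<in> U" "y \<in> (U \<inter> V)\<^sup>\<bottom>"
  shows "norm (closest_point V y) \<le> friedrichs_cos U V * norm y"
proof -
  let ?p = "closest_point V y"
  have p: "?p \<in> V" "?p \<in> (U \<inter> V)\<^sup>\<bottom>"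
    using V y by (simp_all add: closest_point_subspace_in closest_point_in_orthogonal_comp)
  have "(norm ?p)\<^sup>2 = y \<bullet> ?p"
    using closest_point_subspace_orthogonal[OF V p(1), of y]
    by (simp add: power2_norm_eq_inner inner_diff_left)
  also have "\<dots> \<le> friedrichs_cos U V * norm y * norm ?p"
    using inner_le_friedrichs_cos[OF U V y p] .
  finally have "norm ?p * norm ?p \<le> (friedrichs_cos U V * norm y) * norm ?p"
    by (simp add: power2_eq_square)
  then show ?thesis
    using friedrichs_cos_bounds(1)[OF U V]
    by (cases "norm ?p = 0") (auto dest: mult_right_le_imp_le)
qed

section \<open>Contraction of the Douglas-Rachford operator\<close>

context
  fixes U V :: "'a::euclidean_space set"
  assumes U: "subspace U" and V: "subspace V"
begin

text \<open>With \<open>u = P\<^sub>U v\<close>, Cauchy-Schwarz gives \<open>\<parallel>u\<parallel>\<^sup>2 = u \<bullet> v = P\<^sub>V u \<bullet> v \<le> \<parallel>P\<^sub>V u\<parallel> \<parallel>v\<parallel>\<close>. So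
  \<open>\<parallel>u - P\<^sub>V u\<parallel>\<^sup>2 = \<parallel>u\<parallel>\<^sup>2 - \<parallel>P\<^sub>V u\<parallel>\<^sup>2\<close> is at most \<open>(\<parallel>u\<parallel> / \<parallel>v\<parallel>)\<^sup>2 (\<parallel>v\<parallel>\<^sup>2 - \<parallel>u\<parallel>\<^sup>2)\<close>, in which the first factor
  is at most the square of the Friedrichs cosine and the second one is \<open>\<parallel>v - u\<parallel>\<^sup>2\<close>.\<close>

lemma norm_residual_projection_le:
  assumes v: "v \<in> V" "v \<in> (U \<inter> V)\<^sup>\<bottom>"
  defines "u \<equiv> closest_point U v"
  shows "norm (u - closest_point V u) \<le> friedrichs_cos U V * norm (v - u)"
proof (cases "v = 0")
  case True
  then show ?thesis
    using U V by (simp add: u_def closest_point_self subspace_0)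
next
  case False
  let ?c = "friedrichs_cos U V" and ?q = "closest_point V u"
  have c0: "0 \<le> ?c" using friedrichs_cos_bounds(1)[OF U V] .
  have nv: "(norm v)\<^sup>2 = (norm u)\<^sup>2 + (norm (v - u))\<^sup>2"
    unfolding u_def by (rule norm_closest_point_subspace_Pythagorean[OF U])
  have nu: "(norm u)\<^sup>2 = (norm ?q)\<^sup>2 + (norm (u - ?q))\<^sup>2"
    by (rule norm_closest_point_subspace_Pythagorean[OF V])
  have "(norm u)\<^sup>2 = v \<bullet> u"
    using closest_point_subspace_orthogonal[OF U closest_point_subspace_in[OF U], of v v]
    by (simp add: u_def power2_norm_eq_inner inner_diff_left)
  also have "\<dots> = ?q \<bullet> v"
    using closest_point_subspace_orthogonal[OF V v(1), of u]
    by (simp add: inner_diff_left inner_diff_right inner_commute)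
  also have "\<dots> \<le> norm ?q * norm v"
    by (rule norm_cauchy_schwarz)
  finally have "((norm u)\<^sup>2)\<^sup>2 \<le> (norm ?q * norm v)\<^sup>2"
    by (intro power_mono) auto
  then have cs: "(norm u)\<^sup>2 * (norm u)\<^sup>2 \<le> (norm ?q)\<^sup>2 * (norm v)\<^sup>2"
    by (simp add: power_mult_distrib power2_eq_square[of "(norm u)\<^sup>2"])
  have "norm u \<le> ?c * norm v"
    using norm_projection_le[OF V U, of v] v
    by (simp add: u_def Int_commute friedrichs_cos_commute[of V U])
  then have uc: "(norm u)\<^sup>2 \<le> ?c\<^sup>2 * (norm v)\<^sup>2"
    by (metis norm_ge_zero power_mono power_mult_distrib)
  have "(norm (u - ?q))\<^sup>2 * (norm v)\<^sup>2 = (norm u)\<^sup>2 * (norm v)\<^sup>2 - (norm ?q)\<^sup>2 * (norm v)\<^sup>2"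
    using nu by (simp add: algebra_simps)
  also have "\<dots> \<le> (norm u)\<^sup>2 * (norm v)\<^sup>2 - (norm u)\<^sup>2 * (norm u)\<^sup>2"
    using cs by simp
  also have "\<dots> = (norm u)\<^sup>2 * (norm (v - u))\<^sup>2"
    using nv by (simp add: algebra_simps)
  also have "\<dots> \<le> (?c\<^sup>2 * (norm v)\<^sup>2) * (norm (v - u))\<^sup>2"
    using uc by (intro mult_right_mono) auto
  also have "\<dots> = (?c * norm (v - u))\<^sup>2 * (norm v)\<^sup>2"
    by (simp add: power_mult_distrib)
  finally have "(norm (u - ?q))\<^sup>2 \<le> (?c * norm (v - u))\<^sup>2"
    using False by simp
  then show ?thesis
    by (rule power2_le_imp_le) (simp add: c0)
qed

lemma subspace_set_plus: "subspace (U + V)"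
proof -
  have "U + V = {x + y |x y. x \<in> U \<and> y \<in> V}"
    by (auto simp: set_plus_def)
  then show ?thesis
    using subspace_sums[OF U V] by simp
qed

lemma subset_set_plus: "U \<subseteq> U + V" "V \<subseteq> U + V"
  using set_zero_plus2[OF subspace_0[OF V], of U] set_zero_plus2[OF subspace_0[OF U], of V]
  by (simp_all add: add.commute)

text \<open>This is the Friedrichs estimate for the pair of orthogonal complements: for \<open>x \<in> U + V\<close> the
  vector \<open>x - P\<^sub>U x\<close> ranges over the part of the complement of \<open>U\<close> that is orthogonal to the
  intersection of the two complements. It also equals \<open>v - P\<^sub>U v\<close> for some \<open>v \<in> V\<close>, which may
  be shifted to be orthogonal to \<open>U \<inter> V\<close>.\<close>

lemma norm_complement_projection_le:
  assumes x: "x \<in> U + V"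
  defines "p \<equiv> x - closest_point U x"
  shows "norm (p - closest_point V p) \<le> friedrichs_cos U V * norm p"
proof -
  note linU = closest_point_subspace_linear[OF U] and linV = closest_point_subspace_linear[OF V]
  obtain u0 v0 where uv: "u0 \<in> U" "v0 \<in> V" "x = u0 + v0"
    using x by (rule set_plus_elim)
  let ?M = "U \<inter> V"
  have M: "subspace ?M" using U V by (rule subspace_inter)
  define m where "m = closest_point ?M v0"
  have m: "m \<in> U" "m \<in> V"
    using closest_point_subspace_in[OF M, of v0] by (auto simp: m_def)
  define v where "v = v0 - m"
  have v: "v \<in> V" "v \<in> ?M\<^sup>\<bottom>"
    using uv m V closest_point_subspace_orthogonal[OF M, of _ v0]
    by (auto simp: v_def m_def subspace_diff orthogonal_comp_def orthogonal_def inner_commute)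
  have x_eq: "x = v + (u0 + m)" by (simp add: uv v_def)
  have "closest_point U x = closest_point U v + (u0 + m)"
    using uv m U by (simp add: x_eq linear_add[OF linU] closest_point_self)
  then have p: "p = v - closest_point U v" by (simp add: p_def x_eq)
  have "p - closest_point V p = - (closest_point U v - closest_point V (closest_point U v))"
    using v V by (simp add: p linear_diff[OF linV] closest_point_self)
  then show ?thesis
    using norm_residual_projection_le[OF v] by (metis norm_minus_cancel p)
qed

text \<open>With \<open>p = P\<^sub>U x\<close> and \<open>q = x - p\<close>, linearity splits the midpoint into \<open>P\<^sub>V p\<close> and \<open>q - P\<^sub>V q\<close>.
  These are orthogonal, each is shortened by the Friedrichs cosine compared with \<open>p\<close> or \<open>q\<close>, and
  \<open>p\<close> and \<open>q\<close> are orthogonal with sum \<open>x\<close>.\<close>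

lemma norm_Douglas_Rachford_le:
  assumes x: "x \<in> U + V" "x \<in> (U \<inter> V)\<^sup>\<bottom>"
  shows "norm (midpoint x (reflection V (reflection U x))) \<le> friedrichs_cos U V * norm x"
proof -
  note linV = closest_point_subspace_linear[OF V]
  let ?c = "friedrichs_cos U V"
  define p where "p = closest_point U x"
  define q where "q = x - p"
  let ?a = "closest_point V p" and ?b = "q - closest_point V q"
  have y: "reflection U x = p - q" by (simp add: reflection_def p_def q_def scaleR_2)
  have "midpoint x (reflection V (reflection U x)) = ?a + ?b"
    unfolding y reflection_def[of V] linear_diff[OF linV]
    by (simp add: midpoint_def q_def algebra_simps flip: scaleR_2)
  moreover have "orthogonal ?a ?b"
    using closest_point_subspace_orthogonal[OF V closest_point_subspace_in[OF V], of q p]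
    by (simp add: orthogonal_def inner_commute)
  ultimately have "(norm (midpoint x (reflection V (reflection U x))))\<^sup>2 = (norm ?a)\<^sup>2 + (norm ?b)\<^sup>2"
    using norm_add_Pythagorean by simp
  also have "\<dots> \<le> (?c * norm p)\<^sup>2 + (?c * norm q)\<^sup>2"
  proof (intro add_mono power_mono)
    show "norm ?a \<le> ?c * norm p"
      using closest_point_in_orthogonal_comp[OF U _ x(2)] closest_point_subspace_in[OF U, of x]
      unfolding p_def by (intro norm_projection_le[OF U V]) auto
    show "norm ?b \<le> ?c * norm q"
      unfolding q_def p_def using x(1) by (rule norm_complement_projection_le)
  qed simp_all
  also have "\<dots> = (?c * norm x)\<^sup>2"
    unfolding power_mult_distrib p_def q_def norm_closest_point_subspace_Pythagorean[OF U, of x]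
    by (rule distrib_left[symmetric])
  finally show ?thesis
    by (rule power2_le_imp_le) (simp add: friedrichs_cos_bounds(1)[OF U V])
qed

section \<open>Iterating the circumcentering operator\<close>

text \<open>The two conditions under which the contraction estimate applies define an affine set that
  the reflections map into itself, so it contains the affine hull of \<open>s\<close>, \<open>R\<^sub>U s\<close> and
  \<open>R\<^sub>V R\<^sub>U s\<close>. Being the point of this hull nearest to \<open>w\<close>, the circumcenter inherits the
  Douglas-Rachford estimate from the midpoint.\<close>

lemma circumcentering_step:
  assumes w: "w \<in> U \<inter> V" and s: "s \<in> U + V" "s - w \<in> (U \<inter> V)\<^sup>\<bottom>"
  shows "circumcentering U V s \<in> U + V"
    and "circumcentering U V s - w \<in> (U \<inter> V)\<^sup>\<bottom>"
    and "norm (circumcentering U V s - w) \<le> friedrichs_cos U V * norm (s - w)"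
proof -
  let ?y = "reflection U s"
  let ?z = "reflection V ?y"
  let ?A = "{s, ?y, ?z}"
  let ?L = "affine hull ?A"
  let ?D = "{y. y - w \<in> (U + V) \<inter> (U \<inter> V)\<^sup>\<bottom>}"
  have D_sub: "subspace ((U + V) \<inter> (U \<inter> V)\<^sup>\<bottom>)"
    by (intro subspace_inter subspace_set_plus subspace_orthogonal_comp)
  have w': "w \<in> U" "w \<in> V" "w \<in> U + V" using w subset_set_plus by auto
  have refl_diff: "reflection S (y - w) = reflection S y - w" if "subspace S" "w \<in> S" for S y
    using that by (simp add: reflection_def linear_diff[OF closest_point_subspace_linear]
        closest_point_self scaleR_2)
  have D_refl: "reflection S y \<in> ?D" if S: "subspace S" "S \<subseteq> U + V" "U \<inter> V \<subseteq> S" and y: "y \<in> ?D" for S y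
  proof -
    have yw: "y - w \<in> (U + V) \<inter> (U \<inter> V)\<^sup>\<bottom>" using y by simp
    have "closest_point S (y - w) \<in> (U + V) \<inter> (U \<inter> V)\<^sup>\<bottom>"
      using S y closest_point_subspace_in[OF S(1)] closest_point_in_orthogonal_comp[OF S(1,3)] by blast
    then have "reflection S (y - w) \<in> (U + V) \<inter> (U \<inter> V)\<^sup>\<bottom>"
      unfolding reflection_def
      using yw by (intro subspace_diff[OF D_sub _ yw] subspace_scale[OF D_sub])
    then show ?thesis
      using S w by (simp add: refl_diff subsetD)
  qed
  have sD: "s \<in> ?D"
    using s w' subspace_set_plus by (simp add: subspace_diff)
  then have "?A \<subseteq> ?D"
    using D_refl[OF U] D_refl[OF V] subset_set_plus by blast
  moreover have "affine ?D"
  proof -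
    have "?D = (+) w ` ((U + V) \<inter> (U \<inter> V)\<^sup>\<bottom>)"
      by (auto intro!: image_eqI[of _ _ "_ - w"])
    then show ?thesis
      using subspace_imp_affine[OF D_sub] by (metis affine_translation)
  qed
  ultimately have LD: "?L \<subseteq> ?D"
    by (rule hull_minimal)
  have equi: "dist w a = dist w s" if "a \<in> ?A" for a
    using that dist_reflection_fixed_point[OF U w'(1)] dist_reflection_fixed_point[OF V w'(2)]
    by auto
  have cc: "circumcentering U V s = closest_point ?L w"
    unfolding circumcentering_def by (rule circumcenter_eq_closest_point[OF _ equi]) simp_all
  then have in_D: "circumcentering U V s \<in> ?D"
    using LD closest_point_in_set[of ?L w] by auto
  then show "circumcentering U V s - w \<in> (U \<inter> V)\<^sup>\<bottom>" by simp
  have "(circumcentering U V s - w) + w \<in> U + V"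
    using in_D w' subspace_set_plus by (intro subspace_add) auto
  then show "circumcentering U V s \<in> U + V" by simp
  have "midpoint s ?z \<in> ?L"
  proof -
    have "midpoint s ?z \<in> convex hull ?A"
      using midpoint_in_closed_segment[of s ?z] closed_segment_subset_convex_hull[of s ?A ?z]
      by (auto simp: hull_inc)
    then show ?thesis
      using convex_hull_subset_affine_hull by blast
  qed
  then have "norm (circumcentering U V s - w) \<le> norm (midpoint s ?z - w)"
    using closest_point_le[of ?L "midpoint s ?z" w] cc
    by (simp add: dist_norm norm_minus_commute)
  also have "midpoint s ?z - w = midpoint (s - w) (reflection V (reflection U (s - w)))"
    using U V w' by (simp add: refl_diff midpoint_def algebra_simps flip: scaleR_2)
  also have "norm \<dots> \<le> friedrichs_cos U V * norm (s - w)"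
    using sD by (intro norm_Douglas_Rachford_le) auto
  finally show "norm (circumcentering U V s - w) \<le> friedrichs_cos U V * norm (s - w)" .
qed

lemma circumcentering_converges_linearly:
  assumes w: "w \<in> U \<inter> V" and s: "s \<in> U + V" "s - w \<in> (U \<inter> V)\<^sup>\<bottom>"
  shows "converges_linearly (\<lambda>k. (circumcentering U V ^^ k) s) w (friedrichs_cos U V)"
proof -
  let ?c = "friedrichs_cos U V" and ?s = "\<lambda>k. (circumcentering U V ^^ k) s"
  note c = friedrichs_cos_bounds[OF U V]
  have inv: "?s k \<in> U + V \<and> ?s k - w \<in> (U \<inter> V)\<^sup>\<bottom> \<and> norm (?s k - w) \<le> norm (s - w) * ?c ^ k" for k
  proof (induction k)
    case 0
    then show ?case using s by simp
  next
    case (Suc k)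
    then have IH: "?s k \<in> U + V" "?s k - w \<in> (U \<inter> V)\<^sup>\<bottom>" "norm (?s k - w) \<le> norm (s - w) * ?c ^ k"
      by auto
    note step = circumcentering_step[OF w IH(1,2)]
    have "norm (?s (Suc k) - w) \<le> ?c * norm (?s k - w)"
      using step(3) by simp
    also have "\<dots> \<le> ?c * (norm (s - w) * ?c ^ k)"
      using IH(3) c(1) by (rule mult_left_mono)
    finally show ?case
      using step by (simp add: mult_ac)
  qed
  have "(\<lambda>k. norm (s - w) * ?c ^ k) \<longlonglongrightarrow> norm (s - w) * 0"
    using c by (intro tendsto_intros) auto
  then have "(\<lambda>k. norm (s - w) * ?c ^ k) \<longlonglongrightarrow> 0"
    by simp
  with always_eventually have "(\<lambda>k. ?s k - w) \<longlonglongrightarrow> 0"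
    by (rule Lim_null_comparison) (use inv in blast)
  then have "?s \<longlonglongrightarrow> w"
    by (rule LIM_zero_cancel)
  then show ?thesis
    using c inv unfolding converges_linearly_def
    by (intro conjI exI[of _ "norm (s - w)"]) auto
qed

text \<open>The three starting points are projections of \<open>x\<close> onto subspaces between \<open>U \<inter> V\<close> and
  \<open>U + V\<close>. The projection onto such a subspace has the same projection onto \<open>U \<inter> V\<close> as \<open>x\<close>.\<close>

lemma circumcentering_projection_converges_linearly:
  assumes S: "subspace S" "U \<inter> V \<subseteq> S" "S \<subseteq> U + V"
  shows "converges_linearly (\<lambda>k. (circumcentering U V ^^ k) (closest_point S x))
    (closest_point (U \<inter> V) x) (friedrichs_cos U V)"
proof (rule circumcentering_converges_linearly)
  let ?w = "closest_point (U \<inter> V) x"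
  have M: "subspace (U \<inter> V)" using U V by (rule subspace_inter)
  show "?w \<in> U \<inter> V" using M by (rule closest_point_subspace_in)
  show "closest_point S x \<in> U + V" using S closest_point_subspace_in by blast
  have "m \<bullet> (closest_point S x - ?w) = 0" if m: "m \<in> U \<inter> V" for m
  proof -
    have "(x - closest_point S x) \<bullet> m = 0"
      using S m by (intro closest_point_subspace_orthogonal) auto
    moreover have "(x - ?w) \<bullet> m = 0"
      using M m by (rule closest_point_subspace_orthogonal)
    ultimately show ?thesis
      by (simp add: inner_diff_left inner_diff_right inner_commute)
  qed
  then show "closest_point S x - ?w \<in> (U \<inter> V)\<^sup>\<bottom>"
    by (auto simp: orthogonal_comp_def orthogonal_def)
qed

end

theorem theorem2p10:
  fixes U V :: "(real ^ 'n) set" and x :: "real ^ 'n"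
  assumes "subspace U" and "subspace V"
  shows "friedrichs_cos U V \<in> {0..<1} \<and>
    converges_linearly (\<lambda>k. (circumcentering U V ^^ k) (closest_point U x))
      (closest_point (U \<inter> V) x) (friedrichs_cos U V) \<and>
    converges_linearly (\<lambda>k. (circumcentering U V ^^ k) (closest_point V x))
      (closest_point (U \<inter> V) x) (friedrichs_cos U V) \<and>
    converges_linearly (\<lambda>k. (circumcentering U V ^^ k) (closest_point (U + V) x))
      (closest_point (U \<inter> V) x) (friedrichs_cos U V)"
proof -
  note sums = subspace_set_plus[OF assms] subset_set_plus[OF assms]
  show ?thesis
    using friedrichs_cos_bounds[OF assms] assms sums
    by (auto intro!: circumcentering_projection_converges_linearly)
qed

end
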